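(* Let $Q_{n,j}$ ($n,j\ge0$) be the formal power series in $\mathbf x=(x_1,x_2,\dots)$ given by $Q_{n,j}=\sum_{\sigma\in\mathfrak S_n,\ \mathrm{exc}(\sigma)=j}F_{\mathrm{EXD}(\sigma),n}(\mathbf x)$, and let $H(z)=\sum_{n\ge0}h_n(\mathbf x)z^n$. Then $$\sum_{n,j\ge0}Q_{n,j}\,t^jz^n=\frac{(1-t)H(z)}{H(zt)-tH(z)}.$$
   Context: $\mathbf x=(x_1,x_2,\dots)$ is an infinite sequence of commuting indeterminates; $h_n(\mathbf x)=\sum_{1\le i_1\le\dots\le i_n}x_{i_1}\cdots x_{i_n}$ is the complete homogeneous symmetric function, $h_0=1$. $\mathfrak S_n$ is the set of permutations of $[n]=\{1,\dots,n\}$, and $\mathrm{exc}(\sigma)=|\{i\in[n-1]:\sigma(i)>i\}|$. Excedance-descent set: for $\sigma\in\mathfrak S_n$ let $\bar\sigma$ be the word obtained from $\sigma(1)\sigma(2)\cdots\sigma(n)$ by placing a bar over each letter $\sigma(i)$ with $\sigma(i)>i$ (e.g. $531462\mapsto\bar5\bar314\bar62$), viewed as a word over the ordered alphabet $\bar1<\bar2<\dots<\bar n<1<2<\dots<n$. Then $\mathrm{EXD}(\sigma)=\{i\in[n-1]:\bar\sigma_i>\bar\sigma_{i+1}\}$, where $\bar\sigma_i$ is the $i$th letter of $\bar\sigma$. For $n\ge1$ and $S\subseteq[n-1]$, $F_{S,n}(\mathbf x)=\sum x_{i_1}\cdots x_{i_n}$, summed over all sequences of positive integers $i_1\ge i_2\ge\dots\ge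 i_n$ such that $i_j>i_{j+1}$ whenever $j\in S$; and $F_{\emptyset,0}=1$ (so $Q_{0,0}=1$ and $Q_{0,j}=0$ for $j>0$). The identity is one of formal power series in $z$, where the denominator on the right has constant term $1-t$ (invertible in $\mathbb Q(t)$ or $\mathbb Z[[t]]$). *)

theory Defs
  imports
    "HOL-Library.Multiset"
    "HOL-Combinatorics.Permutations"
    "HOL-Computational_Algebra.Formal_Power_Series"
begin

text \<open>
  Formal power series in commuting indeterminates indexed by \<open>'v\<close> (possibly infinitely many),
  with coefficients in \<open>'a\<close>.  The monomial \<open>x\<^sub>v\<^sub>1 \<cdots> x\<^sub>v\<^sub>n\<close> is the multiset \<open>mset [v1, \<dots>, vn]\<close>, and a
  power series is an arbitrary function from monomials to coefficients.
\<close>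

typedef ('v, 'a) mvps = "UNIV :: ('v multiset \<Rightarrow> 'a) set"
  morphisms mcoeff Abs_mvps
  by simp

lemma mcoeff_Abs [simp]: "mcoeff (Abs_mvps f) = f"
  by (simp add: Abs_mvps_inverse)

lemma mvps_eqI: "(\<And>m. mcoeff f m = mcoeff g m) \<Longrightarrow> f = g"
  by (metis ext mcoeff_inject)

definition msplits :: "'v multiset \<Rightarrow> ('v multiset \<times> 'v multiset) set" where
  "msplits m = {(a, b). a + b = m}"

lemma finite_submultisets: "finite {a. a \<subseteq># (m :: 'v multiset)}"
proof -
  have "{a. a \<subseteq># m} \<subseteq> mset ` {xs. set xs \<subseteq> set_mset m \<and> length xs \<le> size m}"
  proof
    fix a assume "a \<in> {a. a \<subseteq># m}"
    hence a: "a \<subseteq># m" by simp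
    obtain xs where xs: "mset xs = a" using ex_mset by blast
    have "set xs \<subseteq> set_mset m" using set_mset_mono[OF a] xs by auto
    moreover have "length xs \<le> size m" using size_mset_mono[OF a] xs by auto
    ultimately show "a \<in> mset ` {xs. set xs \<subseteq> set_mset m \<and> length xs \<le> size m}"
      using xs by blast
  qed
  thus ?thesis by (rule finite_subset) (simp add: finite_lists_length_le)
qed

lemma finite_msplits [simp]: "finite (msplits m)"
proof -
  have "msplits m \<subseteq> {a. a \<subseteq># m} \<times> {a. a \<subseteq># m}"
    by (auto simp: msplits_def)
  thus ?thesis by (rule finite_subset) (simp add: finite_submultisets)
qed

instantiation mvps :: (type, comm_ring_1) comm_ring_1
begin

definition "0 = Abs_mvps (\<lambda>_. 0)"
definition "1 = Abs_mvps (\<lambda>m. if m = {#} then 1 else 0)"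
definition "f + g = Abs_mvps (\<lambda>m. mcoeff f m + mcoeff g m)"
definition "f - g = Abs_mvps (\<lambda>m. mcoeff f m - mcoeff g m)"
definition "- f = Abs_mvps (\<lambda>m. - mcoeff f m)"
definition "f * g = Abs_mvps (\<lambda>m. \<Sum>(a, b)\<in>msplits m. mcoeff f a * mcoeff g b)"

lemmas mvps_defs = zero_mvps_def one_mvps_def plus_mvps_def minus_mvps_def uminus_mvps_def
  times_mvps_def

instance
proof
  fix f g h :: "('a, 'b) mvps"
  show "f + g + h = f + (g + h)" "f + g = g + f" "0 + f = f" "- f + f = 0" "f - g = f + - g"
    by (auto intro!: mvps_eqI simp: mvps_defs)
  show "(0 :: ('a, 'b) mvps) \<noteq> 1"
  proof
    assume "(0 :: ('a, 'b) mvps) = 1"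
    hence "mcoeff (0 :: ('a, 'b) mvps) {#} = mcoeff 1 {#}" by simp
    thus False by (simp add: mvps_defs)
  qed
  show "f * g = g * f"
  proof (rule mvps_eqI)
    fix m
    show "mcoeff (f * g) m = mcoeff (g * f) m"
      unfolding times_mvps_def mcoeff_Abs
      by (rule sum.reindex_bij_witness[of _ prod.swap prod.swap])
         (auto simp: msplits_def ac_simps)
  qed
  show "(f + g) * h = f * h + g * h"
    by (rule mvps_eqI)
       (simp add: times_mvps_def plus_mvps_def case_prod_unfold distrib_right sum.distrib)
  show "1 * f = f"
  proof (rule mvps_eqI)
    fix m
    have "mcoeff (1 * f) m = (\<Sum>p\<in>msplits m. if p = ({#}, m) then mcoeff f m else 0)"
      unfolding times_mvps_def mcoeff_Abs one_mvps_def
      by (rule sum.cong) (auto simp: msplits_def split: if_splits)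
    also have "\<dots> = mcoeff f m"
      by (subst sum.delta, rule finite_msplits) (auto simp: msplits_def)
    finally show "mcoeff (1 * f) m = mcoeff f m" .
  qed
  show "f * g * h = f * (g * h)"
  proof (rule mvps_eqI)
    fix m
    have "mcoeff (f * g * h) m =
        (\<Sum>p\<in>msplits m. \<Sum>q\<in>msplits (fst p). mcoeff f (fst q) * mcoeff g (snd q) * mcoeff h (snd p))"
      by (simp add: times_mvps_def case_prod_unfold sum_distrib_right)
    also have "\<dots> = (\<Sum>(p, q)\<in>Sigma (msplits m) (\<lambda>p. msplits (fst p)).
        mcoeff f (fst q) * mcoeff g (snd q) * mcoeff h (snd p))"
      by (rule sum.Sigma) auto
    also have "\<dots> = (\<Sum>(p, q)\<in>Sigma (msplits m) (\<lambda>p. msplits (snd p)).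
        mcoeff f (fst p) * (mcoeff g (fst q) * mcoeff h (snd q)))"
      by (rule sum.reindex_bij_witness
            [of _ "\<lambda>(p, q). ((fst p + fst q, snd q), (fst p, fst q))"
                  "\<lambda>(p, q). ((fst q, snd q + snd p), (snd q, snd p))"])
         (auto simp: msplits_def ac_simps)
    also have "\<dots> = (\<Sum>p\<in>msplits m. \<Sum>q\<in>msplits (snd p).
        mcoeff f (fst p) * (mcoeff g (fst q) * mcoeff h (snd q)))"
      by (rule sum.Sigma[symmetric]) auto
    also have "\<dots> = mcoeff (f * (g * h)) m"
      by (simp add: times_mvps_def case_prod_unfold sum_distrib_left)
    finally show "mcoeff (f * g * h) m = mcoeff (f * (g * h)) m" .
  qed
qed

end

text \<open>
  The formal sum of \<open>x\<^sub>w\<^sub>1 \<cdots> x\<^sub>w\<^sub>n\<close> over all words \<open>w\<close> in \<open>A\<close>.  Only finitely many words share a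
  given monomial, so the cardinality is that of a finite set even when \<open>A\<close> is infinite.
\<close>

definition word_series :: "'v list set \<Rightarrow> ('v, 'a :: comm_ring_1) mvps" where
  "word_series A = Abs_mvps (\<lambda>m. of_nat (card {w \<in> A. mset w = m}))"

lemma finite_words_of_monomial: "finite {w \<in> A. mset w = m}"
  by (rule finite_subset[OF _ mset_eq_finite[of "SOME w. mset w = m"]])
     (use someI_ex[OF ex_mset[of m]] in auto)

text \<open>
  Variables are indexed by the positive integers; the indeterminate with index 0 is available in
  the type but occurs in none of the series below.  Words \<open>i\<^sub>1 \<dots> i\<^sub>n\<close> are 0-based lists, so \<open>i\<^sub>j\<close> is
  \<open>w ! (j - 1)\<close>.
\<close>

type_synonym xps = "(nat, int) mvps"

definition hsym :: "nat \<Rightarrow> xps" where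
  "hsym n = word_series {w. length w = n \<and> (\<forall>i\<in>set w. 1 \<le> i) \<and> sorted w}"

definition Fquasi :: "nat set \<Rightarrow> nat \<Rightarrow> xps" where
  "Fquasi S n = word_series {w. length w = n \<and> (\<forall>i\<in>set w. 1 \<le> i) \<and>
     (\<forall>j\<in>{1..<n}. w ! (j - 1) \<ge> w ! j) \<and>
     (\<forall>j\<in>S. w ! (j - 1) > w ! j)}"

definition exc :: "nat \<Rightarrow> (nat \<Rightarrow> nat) \<Rightarrow> nat" where
  "exc n \<sigma> = card {i \<in> {1..<n}. \<sigma> i > i}"

datatype letter = Barred nat | Plain nat

fun letter_less :: "letter \<Rightarrow> letter \<Rightarrow> bool" where
  "letter_less (Barred a) (Barred b) \<longleftrightarrow> a < b"
| "letter_less (Barred a) (Plain b) \<longleftrightarrow> True"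
| "letter_less (Plain a) (Barred b) \<longleftrightarrow> False"
| "letter_less (Plain a) (Plain b) \<longleftrightarrow> a < b"

definition bar_word :: "(nat \<Rightarrow> nat) \<Rightarrow> nat \<Rightarrow> letter" where
  "bar_word \<sigma> i = (if \<sigma> i > i then Barred (\<sigma> i) else Plain (\<sigma> i))"

definition EXD :: "nat \<Rightarrow> (nat \<Rightarrow> nat) \<Rightarrow> nat set" where
  "EXD n \<sigma> = {i \<in> {1..<n}. letter_less (bar_word \<sigma> (i + 1)) (bar_word \<sigma> i)}"

definition Qeuler :: "nat \<Rightarrow> nat \<Rightarrow> xps" where
  "Qeuler n j = (\<Sum>\<sigma> | \<sigma> permutes {1..n} \<and> exc n \<sigma> = j. Fquasi (EXD n \<sigma>) n)"

text \<open>
  The ring of the identity is \<open>\<int>[[x]][[t]][[z]]\<close>, i.e. \<open>xps fps fps\<close>: the inner series variable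
  is \<open>t\<close>, the outer one is \<open>z\<close>.
\<close>

definition tvar :: "xps fps fps" where
  "tvar = fps_const fps_X"

definition zvar :: "xps fps fps" where
  "zvar = fps_X"

definition Hgen :: "xps fps fps" where
  "Hgen = Abs_fps (\<lambda>n. fps_const (hsym n))"

definition Qgen :: "xps fps fps" where
  "Qgen = Abs_fps (\<lambda>n. Abs_fps (\<lambda>j. Qeuler n j))"

text \<open>
  The quotient by a unit of a commutative ring (the library's division on power series needs a
  coefficient type with an \<open>inverse\<close> operation).  It is meaningful only if \<open>d dvd 1\<close>.
\<close>

definition unit_quot :: "'a :: comm_ring_1 \<Rightarrow> 'a \<Rightarrow> 'a" where
  "unit_quot a d = a * (THE u. d * u = 1)"

lemma unit_quot_eq_iff:
  assumes "d dvd 1"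
  shows "q = unit_quot a d \<longleftrightarrow> q * d = a"
proof -
  obtain u where u: "d * u = 1" using assms by (metis dvdE)
  have "(THE u. d * u = 1) = u"
  proof (rule the_equality)
    show "d * u = 1" by (fact u)
    fix v assume v: "d * v = 1"
    have "v = v * (d * u)" using u by simp
    also have "\<dots> = (d * v) * u" by (simp only: ac_simps)
    finally show "v = u" using v by simp
  qed
  hence *: "unit_quot a d = a * u" by (simp add: unit_quot_def)
  have "a * u * d = a * (d * u)" "q * d * u = q * (d * u)" by (simp_all only: ac_simps)
  thus ?thesis using u * by auto
qed

end

theory Submission
  imports Defs "HOL-Library.Product_Lexorder"
begin

text \<open>
  Fix a monomial \<open>m\<close>, i.e. a weakly decreasing word \<open>w\<close>, which cuts the positions \<open>1, \<dots>, n\<close> into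
  blocks, one for each letter \<open>v\<close>, of size \<open>m v\<close>.  A permutation \<open>\<sigma>\<close> contributes to the coefficient of
  \<open>m\<close> iff its barred word increases along each block, and then \<open>\<sigma>\<close> is determined by recording for
  every value its block and whether it is barred.  The admissible records are those in which
  every value is chosen independently from an explicit set, so the coefficient is
  \<open>[y\<^sup>m] \<Prod>\<^sub>v (L\<^sub>v - t y\<^sub>v) L\<^sub>v\<^bsup>m v - 1\<^esup>\<close> with
  \<open>L\<^sub>v = t \<Sum>\<^sub>k\<^sub>>\<^sub>v y\<^sub>k + (1 + t) y\<^sub>v + \<Sum>\<^sub>k\<^sub><\<^sub>v y\<^sub>k\<close>.

  Let \<open>M\<close> be the series with coefficients \<open>[y\<^sup>m] \<Prod>\<^sub>v L\<^sub>v\<^bsup>m v\<^esup>\<close>, let \<open>E(u) = \<Prod>\<^sub>v (1 + u x\<^sub>v)\<close> and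
  \<open>H(u) = \<Prod>\<^sub>v (1 - u x\<^sub>v)\<^sup>-\<^sup>1\<close>.  Then \<open>M E(u)\<close> has coefficients
  \<open>[y\<^sup>m] \<Prod>\<^sub>v (L\<^sub>v + u y\<^sub>v) L\<^sub>v\<^bsup>m v - 1\<^esup>\<close>, so \<open>Q = M E(-t)\<close>.  For \<open>m \<noteq> 1\<close>, in the letters of \<open>m\<close>,
  the product telescopes to \<open>\<Prod>\<^sub>v (L\<^sub>v - y\<^sub>v) = t \<Prod>\<^sub>v (L\<^sub>v - t y\<^sub>v)\<close>, whence
  \<open>M E(-1) = t Q + (1 - t)\<close>.  Since \<open>M = Q H(t) = M E(-1) H(1)\<close>, this is
  \<open>Q (H(t) - t H(1)) = (1 - t) H(1)\<close>.  The variable \<open>z\<close> only records the degree: \<open>H(1)\<close> and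
  \<open>H(t)\<close> are \<open>H(z)\<close> and \<open>H(zt)\<close> at \<open>z = 1\<close>.
\<close>

section \<open>Monomials, linear forms and restriction of variables\<close>

lemma mcoeff_zero [simp]: "mcoeff 0 m = 0"
  and mcoeff_one: "mcoeff 1 m = (if m = {#} then 1 else 0)"
  and mcoeff_add [simp]: "mcoeff (f + g) m = mcoeff f m + mcoeff g m"
  and mcoeff_diff [simp]: "mcoeff (f - g) m = mcoeff f m - mcoeff g m"
  and mcoeff_mult: "mcoeff (f * g) m = (\<Sum>(a, b)\<in>msplits m. mcoeff f a * mcoeff g b)"
  by (simp_all add: mvps_defs)

lemma mcoeff_sum [simp]: "mcoeff (sum f A) m = (\<Sum>x\<in>A. mcoeff (f x) m)"
  by (induction A rule: infinite_finite_induct) auto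

definition mmonom :: "'a::comm_ring_1 \<Rightarrow> 'v multiset \<Rightarrow> ('v, 'a) mvps" where
  "mmonom c a = Abs_mvps (\<lambda>m. if m = a then c else 0)"

lemma mcoeff_mmonom: "mcoeff (mmonom c a) m = (if m = a then c else 0)"
  by (simp add: mmonom_def)

lemma mmonom_one: "mmonom 1 {#} = 1"
  by (rule mvps_eqI) (simp add: mcoeff_mmonom mcoeff_one)

lemma mcoeff_mmonom_mult:
  "mcoeff (mmonom c a * f) m = (if a \<subseteq># m then c * mcoeff f (m - a) else 0)"
proof -
  have "mcoeff (mmonom c a * f) m =
      (\<Sum>p\<in>msplits m. if p = (a, m - a) then c * mcoeff f (m - a) else 0)"
    unfolding mcoeff_mult by (rule sum.cong) (auto simp: msplits_def mcoeff_mmonom split: if_splits)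
  also have "\<dots> = (if (a, m - a) \<in> msplits m then c * mcoeff f (m - a) else 0)"
    by (rule sum.delta) simp
  also have "(a, m - a) \<in> msplits m \<longleftrightarrow> a \<subseteq># m"
    unfolding msplits_def
    by (auto intro: subset_mset.add_diff_inverse) (metis mset_subset_eq_add_left)
  finally show ?thesis by simp
qed

lemma mmonom_mult: "mmonom c a * mmonom d b = mmonom (c * d) (a + b)"
  by (rule mvps_eqI) (auto simp: mcoeff_mmonom_mult mcoeff_mmonom)

lemma prod_mmonom: "(\<Prod>x\<in>A. mmonom (c x) (a x)) = mmonom (\<Prod>x\<in>A. c x) (\<Sum>x\<in>A. a x)"
  by (induction A rule: infinite_finite_induct) (auto simp: mmonom_one mmonom_mult)

lemma mcoeff_prod_sum_mmonom:
  assumes "finite I" "\<And>i. i \<in> I \<Longrightarrow> finite (C i)"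
  shows "mcoeff (\<Prod>i\<in>I. \<Sum>c\<in>C i. mmonom (wt c) (a c)) m =
    (\<Sum>g | g \<in> PiE I C \<and> (\<Sum>i\<in>I. a (g i)) = m. \<Prod>i\<in>I. wt (g i))"
proof -
  have "mcoeff (\<Prod>i\<in>I. \<Sum>c\<in>C i. mmonom (wt c) (a c)) m =
      (\<Sum>g\<in>PiE I C. if (\<Sum>i\<in>I. a (g i)) = m then \<Prod>i\<in>I. wt (g i) else 0)"
    using assms by (simp add: prod_sum_PiE prod_mmonom mcoeff_mmonom eq_commute[of m])
  also have "\<dots> = (\<Sum>g\<in>{g \<in> PiE I C. (\<Sum>i\<in>I. a (g i)) = m}. \<Prod>i\<in>I. wt (g i))"
    using assms by (intro sum.inter_filter[symmetric] finite_PiE)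
  finally show ?thesis .
qed

definition linear_form :: "('v \<Rightarrow> 'a::comm_ring_1) \<Rightarrow> ('v, 'a) mvps" where
  "linear_form a = Abs_mvps (\<lambda>m. \<Sum>k\<in>set_mset m. if m = {#k#} then a k else 0)"

lemma linear_form_cong: "(\<And>k. a k = b k) \<Longrightarrow> linear_form a = linear_form b"
  by (intro arg_cong[of _ _ linear_form] ext)

lemma mmonom_single: "mmonom c {#v#} = linear_form (\<lambda>k. if k = v then c else 0)"
  by (rule mvps_eqI) (auto simp: linear_form_def mcoeff_mmonom intro!: sum.neutral)

lemma linear_form_add: "linear_form a + linear_form b = linear_form (\<lambda>k. a k + b k)"
  by (rule mvps_eqI) (auto simp: linear_form_def intro!: sum.cong simp flip: sum.distrib)

lemma linear_form_smult: "mmonom c {#} * linear_form a = linear_form (\<lambda>k. c * a k)"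
  by (rule mvps_eqI)
    (auto simp: linear_form_def mcoeff_mmonom_mult sum_distrib_left intro!: sum.cong)

lemma sum_mmonom_single:
  "finite A \<Longrightarrow> (\<Sum>k\<in>A. mmonom c {#k#}) = linear_form (\<lambda>k. if k \<in> A then c else 0)"
proof (induction A rule: finite_induct)
  case empty
  show ?case by (rule mvps_eqI) (simp add: linear_form_def)
next
  case (insert v A)
  thus ?case
    by (auto simp: mmonom_single linear_form_add intro!: linear_form_cong)
qed

definition restrict_vars :: "'v set \<Rightarrow> ('v, 'a::comm_ring_1) mvps \<Rightarrow> ('v, 'a) mvps" where
  "restrict_vars V f = Abs_mvps (\<lambda>m. if set_mset m \<subseteq> V then mcoeff f m else 0)"

lemma mcoeff_restrict_vars:
  "mcoeff (restrict_vars V f) m = (if set_mset m \<subseteq> V then mcoeff f m else 0)"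
  by (simp add: restrict_vars_def)

lemma restrict_vars_diff: "restrict_vars V (f - g) = restrict_vars V f - restrict_vars V g"
  by (rule mvps_eqI) (simp add: mcoeff_restrict_vars)

lemma restrict_vars_one: "restrict_vars V 1 = 1"
  by (rule mvps_eqI) (simp add: mcoeff_restrict_vars mcoeff_one)

lemma restrict_vars_mult: "restrict_vars V (f * g) = restrict_vars V f * restrict_vars V g"
proof (rule mvps_eqI)
  fix m
  have "(\<Sum>p\<in>msplits m. mcoeff (restrict_vars V f) (fst p) * mcoeff (restrict_vars V g) (snd p)) =
     (\<Sum>p\<in>msplits m. if set_mset m \<subseteq> V then mcoeff f (fst p) * mcoeff g (snd p) else 0)"
    by (rule sum.cong) (auto simp: mcoeff_restrict_vars msplits_def)
  thus "mcoeff (restrict_vars V (f * g)) m = mcoeff (restrict_vars V f * restrict_vars V g) m"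
    by (simp add: mcoeff_mult mcoeff_restrict_vars case_prod_unfold)
qed

lemma restrict_vars_prod: "restrict_vars V (prod f A) = (\<Prod>x\<in>A. restrict_vars V (f x))"
  by (induction A rule: infinite_finite_induct) (simp_all add: restrict_vars_one restrict_vars_mult)

lemma restrict_vars_linear_form:
  "restrict_vars V (linear_form a) = linear_form (\<lambda>k. if k \<in> V then a k else 0)"
  by (rule mvps_eqI)
    (auto simp: linear_form_def mcoeff_restrict_vars intro!: sum.cong sum.neutral)

section \<open>Elementary, complete and diagonal series\<close>

definition elementary_series :: "'a::comm_ring_1 \<Rightarrow> ('v, 'a) mvps" where
  "elementary_series u = Abs_mvps (\<lambda>m. if m = mset_set (set_mset m) then u ^ size m else 0)"

definition complete_series :: "'a::comm_ring_1 \<Rightarrow> ('v, 'a) mvps" where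
  "complete_series u = Abs_mvps (\<lambda>m. u ^ size m)"

definition diagonal_series :: "('v \<Rightarrow> ('v, 'a::comm_ring_1) mvps) \<Rightarrow> ('v, 'a) mvps" where
  "diagonal_series f = Abs_mvps (\<lambda>m. mcoeff (\<Prod>v\<in>set_mset m. f v ^ count m v) m)"

lemma mset_set_subseteq_mset: "S \<subseteq> set_mset m \<Longrightarrow> mset_set S \<subseteq># m"
  by (meson finite_set_mset mset_set_set_mset_msubset subset_imp_msubset_mset_set
      subset_mset.order_trans)

lemma mcoeff_mult_elementary_series:
  "mcoeff (f * elementary_series u) m =
     (\<Sum>S\<in>Pow (set_mset m). u ^ card S * mcoeff f (m - mset_set S))"
proof -
  let ?P = "{p \<in> msplits m. snd p = mset_set (set_mset (snd p))}"
  have "mcoeff (f * elementary_series u) m =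
      (\<Sum>p\<in>msplits m. if snd p = mset_set (set_mset (snd p))
         then u ^ size (snd p) * mcoeff f (fst p) else 0)"
    unfolding mcoeff_mult case_prod_unfold
    by (rule sum.cong) (auto simp: elementary_series_def mult.commute)
  also have "\<dots> = (\<Sum>p\<in>?P. u ^ size (snd p) * mcoeff f (fst p))"
    by (rule sum.inter_filter[symmetric]) simp
  also have "\<dots> = (\<Sum>S\<in>Pow (set_mset m). u ^ card S * mcoeff f (m - mset_set S))"
  proof (rule sum.reindex_bij_witness
      [of _ "\<lambda>S. (m - mset_set S, mset_set S)" "\<lambda>p. set_mset (snd p)"])
    fix p assume "p \<in> ?P"
    hence m: "m = fst p + snd p" and sq: "mset_set (set_mset (snd p)) = snd p"
      by (auto simp: msplits_def)
    show "(m - mset_set (set_mset (snd p)), mset_set (set_mset (snd p))) = p"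
      unfolding sq m by simp
    show "set_mset (snd p) \<in> Pow (set_mset m)" unfolding m by auto
    show "u ^ card (set_mset (snd p)) * mcoeff f (m - mset_set (set_mset (snd p))) =
        u ^ size (snd p) * mcoeff f (fst p)"
      unfolding sq m by (simp flip: size_mset_set add: sq)
  next
    fix S assume "S \<in> Pow (set_mset m)"
    hence S: "S \<subseteq> set_mset m" "finite S" by (auto intro: finite_subset)
    show "set_mset (snd (m - mset_set S, mset_set S)) = S" using S by simp
    show "(m - mset_set S, mset_set S) \<in> ?P"
      using S mset_set_subseteq_mset[OF S(1)] by (simp add: msplits_def)
  qed
  finally show ?thesis .
qed

lemma mcoeff_diagonal_series:
  assumes "finite T" "set_mset m \<subseteq> T"
  shows "mcoeff (diagonal_series f) m = mcoeff (\<Prod>v\<in>T. f v ^ count m v) m"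
proof -
  have "(\<Prod>v\<in>T. f v ^ count m v) = (\<Prod>v\<in>set_mset m. f v ^ count m v)"
    using assms by (intro prod.mono_neutral_right) (auto simp: not_in_iff)
  thus ?thesis by (simp add: diagonal_series_def)
qed

lemma prod_power_count_diff_mset_set:
  fixes f :: "'v \<Rightarrow> 'r::comm_monoid_mult"
  assumes "S \<subseteq> set_mset m"
  shows "(\<Prod>v\<in>set_mset m - S. f v) * (\<Prod>v\<in>set_mset m. f v ^ (count m v - 1)) =
    (\<Prod>v\<in>set_mset m. f v ^ count (m - mset_set S) v)"
proof -
  have fin: "finite S" using assms by (rule finite_subset) simp
  have "(\<Prod>v\<in>set_mset m - S. f v) = (\<Prod>v\<in>set_mset m. if v \<in> S then 1 else f v)"
    by (simp add: prod.If_cases Diff_eq)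
  hence "(\<Prod>v\<in>set_mset m - S. f v) * (\<Prod>v\<in>set_mset m. f v ^ (count m v - 1)) =
      (\<Prod>v\<in>set_mset m. (if v \<in> S then 1 else f v) * f v ^ (count m v - 1))"
    by (simp add: prod.distrib)
  also have "\<dots> = (\<Prod>v\<in>set_mset m. f v ^ count (m - mset_set S) v)"
  proof (rule prod.cong[OF refl])
    fix v assume "v \<in> set_mset m"
    then obtain n where "count m v = Suc n" by (metis count_greater_zero_iff gr0_implies_Suc)
    thus "(if v \<in> S then 1 else f v) * f v ^ (count m v - 1) = f v ^ count (m - mset_set S) v"
      using fin by (simp add: count_mset_set')
  qed
  finally show ?thesis .
qed

lemma mcoeff_diagonal_series_mult_elementary_series:
  "mcoeff (diagonal_series f * elementary_series u) m =
    mcoeff (\<Prod>v\<in>set_mset m. (f v + mmonom u {#v#}) * f v ^ (count m v - 1)) m"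
proof -
  let ?T = "set_mset m"
  let ?R = "\<Prod>v\<in>?T. f v ^ (count m v - 1)"
  have "(\<Prod>v\<in>?T. (f v + mmonom u {#v#}) * f v ^ (count m v - 1)) =
      (\<Prod>v\<in>?T. mmonom u {#v#} + f v) * ?R"
    by (simp add: prod.distrib add.commute)
  also have "\<dots> = (\<Sum>S\<in>Pow ?T. (\<Prod>v\<in>S. mmonom u {#v#}) * ((\<Prod>v\<in>?T - S. f v) * ?R))"
    by (simp add: prod_add sum_distrib_right mult.assoc)
  also have "\<dots> = (\<Sum>S\<in>Pow ?T. mmonom (u ^ card S) (mset_set S) *
      (\<Prod>v\<in>?T. f v ^ count (m - mset_set S) v))"
    by (rule sum.cong[OF refl])
      (simp add: prod_mmonom prod_power_count_diff_mset_set del: count_diff One_nat_def)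
  also have "mcoeff \<dots> m = (\<Sum>S\<in>Pow ?T. u ^ card S * mcoeff (diagonal_series f) (m - mset_set S))"
    unfolding mcoeff_sum
  proof (rule sum.cong[OF refl])
    fix S assume "S \<in> Pow ?T"
    moreover have "set_mset (m - mset_set S) \<subseteq> ?T" by (meson in_diffD subsetI)
    ultimately show "mcoeff (mmonom (u ^ card S) (mset_set S) *
        (\<Prod>v\<in>?T. f v ^ count (m - mset_set S) v)) m =
      u ^ card S * mcoeff (diagonal_series f) (m - mset_set S)"
      by (simp add: mcoeff_mmonom_mult mset_set_subseteq_mset mcoeff_diagonal_series[of ?T])
  qed
  finally show ?thesis by (simp add: mcoeff_mult_elementary_series)
qed

lemma complete_series_eq_diagonal_series:
  "complete_series u = diagonal_series (\<lambda>v. mmonom u {#v#})"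
proof (rule mvps_eqI)
  fix m :: "'v multiset"
  have "mmonom u {#v#} ^ k = mmonom (u ^ k) (replicate_mset k v)" for k and v :: 'v
    by (induction k) (simp_all add: mmonom_one mmonom_mult)
  moreover have "(\<Sum>v\<in>set_mset m. replicate_mset (count m v) v) = m"
    by (rule multiset_eqI) (simp add: count_sum not_in_iff)
  ultimately have "(\<Prod>v\<in>set_mset m. mmonom u {#v#} ^ count m v) = mmonom (u ^ size m) m"
    by (simp add: prod_mmonom size_multiset_overloaded_eq power_sum)
  thus "mcoeff (complete_series u) m = mcoeff (diagonal_series (\<lambda>v. mmonom u {#v#})) m"
    by (simp add: complete_series_def diagonal_series_def mcoeff_mmonom)
qed

lemma complete_series_mult_elementary_series:
  "complete_series u * elementary_series (- u) = (1 :: ('v, 'a::comm_ring_1) mvps)"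
proof (rule mvps_eqI)
  fix m :: "'v multiset"
  have "mmonom u {#v#} + mmonom (- u) {#v#} = 0" for v :: 'v
    by (rule mvps_eqI) (simp add: mcoeff_mmonom)
  thus "mcoeff (complete_series u * elementary_series (- u)) m = mcoeff 1 m"
    by (cases "m = {#}")
      (simp_all add: complete_series_eq_diagonal_series mcoeff_one power_0_left
        mcoeff_diagonal_series_mult_elementary_series)
qed

section \<open>The Eulerian product of linear forms\<close>

text \<open>
  The coefficient of \<open>y\<^sub>k\<close> counts the ways in which a value lying in the block of \<open>v\<close>, but not its
  first element, can occur in the block of \<open>k\<close>: as a barred letter (weight \<open>t\<close>) or as a plain one
  (weight 1).  Blocks of larger letters come first, since words are weakly decreasing.
\<close>

definition eulerian_form :: "'a::comm_ring_1 \<Rightarrow> 'v::linorder \<Rightarrow> ('v, 'a) mvps" where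
  "eulerian_form t v = linear_form (\<lambda>k. if v < k then t else if k = v then 1 + t else 1)"

lemma eulerian_form_add_mmonom:
  "eulerian_form t v + mmonom u {#v#} =
     linear_form (\<lambda>k. if v < k then t else if k = v then 1 + t + u else 1)"
  by (auto simp: eulerian_form_def mmonom_single linear_form_add intro!: linear_form_cong)

text \<open>The strict upper set of an element of \<open>T\<close> is the weak upper set of its successor.\<close>

lemma prod_strict_upper_sets:
  fixes \<phi> :: "'v::linorder set \<Rightarrow> 'r::comm_monoid_mult"
  assumes "finite T" "T \<noteq> {}"
  shows "(\<Prod>v\<in>T. \<phi> {k\<in>T. v < k}) = \<phi> {} * (\<Prod>v\<in>T - {Min T}. \<phi> {k\<in>T. v \<le> k})"
  using assms
proof (induction T rule: finite_linorder_min_induct)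
  case empty
  thus ?case by simp
next
  case (insert b A)
  have "Min (insert b A) = b" using insert.hyps by (auto intro!: Min_eqI)
  hence b: "b \<notin> A" "insert b A - {Min (insert b A)} = A" using insert.hyps by auto
  have upper: "{k \<in> insert b A. v < k} = {k \<in> A. v < k}" "{k \<in> insert b A. v \<le> k} = {k \<in> A. v \<le> k}"
    if "v \<in> A" for v using insert.hyps that by auto
  have upper_b: "{k \<in> insert b A. b < k} = A" using insert.hyps by auto
  show ?case
  proof (cases "A = {}")
    case True
    thus ?thesis by (auto intro: arg_cong)
  next
    case False
    have "(\<Prod>v\<in>insert b A. \<phi> {k \<in> insert b A. v < k}) = \<phi> A * (\<Prod>v\<in>A. \<phi> {k \<in> A. v < k})"
      using insert.hyps b by (simp add: upper upper_b del: insert_iff)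
    also have "\<dots> = \<phi> {} * (\<phi> A * (\<Prod>v\<in>A - {Min A}. \<phi> {k \<in> A. v \<le> k}))"
      using insert.IH False by (simp add: mult.left_commute)
    also have "\<phi> A = \<phi> {k \<in> A. Min A \<le> k}" using insert.hyps by (auto intro: arg_cong)
    also have "\<dots> * (\<Prod>v\<in>A - {Min A}. \<phi> {k \<in> A. v \<le> k}) = (\<Prod>v\<in>A. \<phi> {k \<in> A. v \<le> k})"
      using insert.hyps False by (intro prod.remove[symmetric]) auto
    also have "\<dots> = (\<Prod>v\<in>insert b A - {Min (insert b A)}. \<phi> {k \<in> insert b A. v \<le> k})"
      by (simp add: b upper del: insert_iff)
    finally show ?thesis .
  qed
qed

lemma prod_eulerian_form_telescope:
  fixes t :: "'a::comm_ring_1" and T :: "'v::linorder set"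
  assumes "finite T" "T \<noteq> {}"
  shows "restrict_vars T (\<Prod>v\<in>T. eulerian_form t v + mmonom (- 1) {#v#}) =
    mmonom t {#} * restrict_vars T (\<Prod>v\<in>T. eulerian_form t v + mmonom (- t) {#v#})"
proof -
  define \<phi> :: "'v set \<Rightarrow> ('v, 'a) mvps" where
    "\<phi> U = linear_form (\<lambda>k. if k \<in> U then t else if k \<in> T then 1 else 0)" for U
  let ?P = "\<Prod>v\<in>T - {Min T}. \<phi> {k\<in>T. v \<le> k}"
  have "restrict_vars T (eulerian_form t v + mmonom (- 1) {#v#}) = \<phi> {k\<in>T. v \<le> k}"
    "restrict_vars T (eulerian_form t v + mmonom (- t) {#v#}) = \<phi> {k\<in>T. v < k}" for v
    unfolding eulerian_form_add_mmonom restrict_vars_linear_form \<phi>_def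
    by (auto intro!: linear_form_cong)
  moreover have "(\<Prod>v\<in>T. \<phi> {k\<in>T. v \<le> k}) = \<phi> {k\<in>T. Min T \<le> k} * ?P"
    using assms by (intro prod.remove) auto
  moreover have "\<phi> {k\<in>T. Min T \<le> k} = mmonom t {#} * \<phi> {}"
    unfolding \<phi>_def linear_form_smult using assms by (intro linear_form_cong) auto
  ultimately show ?thesis
    by (simp add: restrict_vars_prod prod_strict_upper_sets[OF assms] mult.assoc)
qed

definition eulerian_series :: "'a::comm_ring_1 \<Rightarrow> ('v::linorder, 'a) mvps" where
  "eulerian_series t = diagonal_series (eulerian_form t) * elementary_series (- t)"

lemma mcoeff_eulerian_series:
  "mcoeff (eulerian_series t) m = mcoeff (\<Prod>v\<in>set_mset m.
     (eulerian_form t v + mmonom (- t) {#v#}) * eulerian_form t v ^ (count m v - 1)) m"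
  by (simp add: eulerian_series_def mcoeff_diagonal_series_mult_elementary_series)

lemma diagonal_eulerian_form_mult_elementary_series:
  "diagonal_series (eulerian_form t) * elementary_series (- 1) =
     mmonom t {#} * eulerian_series t + mmonom (1 - t) {#}"
proof (rule mvps_eqI)
  fix m :: "'a multiset"
  show "mcoeff (diagonal_series (eulerian_form t) * elementary_series (- 1)) m =
    mcoeff (mmonom t {#} * eulerian_series t + mmonom (1 - t) {#}) m"
  proof (cases "m = {#}")
    case True
    thus ?thesis
      by (simp add: mcoeff_eulerian_series mcoeff_diagonal_series_mult_elementary_series
          mcoeff_mmonom_mult mcoeff_mmonom mcoeff_one)
  next
    case False
    let ?T = "set_mset m"
    let ?R = "restrict_vars ?T (\<Prod>v\<in>?T. eulerian_form t v ^ (count m v - 1))"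
    let ?A = "\<lambda>u. restrict_vars ?T (\<Prod>v\<in>?T. eulerian_form t v + mmonom u {#v#})"
    have restrict: "mcoeff (\<Prod>v\<in>?T. (eulerian_form t v + mmonom u {#v#}) *
        eulerian_form t v ^ (count m v - 1)) m = mcoeff (?A u * ?R) m" for u
      by (simp add: prod.distrib mcoeff_restrict_vars flip: restrict_vars_mult)
    have "mcoeff (diagonal_series (eulerian_form t) * elementary_series (- 1)) m =
        mcoeff (?A (- 1) * ?R) m"
      by (simp only: mcoeff_diagonal_series_mult_elementary_series restrict)
    also have "\<dots> = t * mcoeff (?A (- t) * ?R) m"
      using False by (simp add: prod_eulerian_form_telescope mult.assoc mcoeff_mmonom_mult)
    also have "\<dots> = mcoeff (mmonom t {#} * eulerian_series t) m"
      by (simp add: mcoeff_mmonom_mult mcoeff_eulerian_series restrict del: One_nat_def)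
    finally show ?thesis using False by (simp add: mcoeff_mmonom)
  qed
qed

lemma eulerian_series_mult_complete_series_diff:
  "eulerian_series t * (complete_series t - mmonom t {#} * complete_series 1) =
     mmonom (1 - t) {#} * complete_series 1"
proof -
  let ?M = "diagonal_series (eulerian_form t)"
  have "eulerian_series t * complete_series t = ?M * (complete_series t * elementary_series (- t))"
    by (simp add: eulerian_series_def ac_simps)
  also have "\<dots> = ?M * (complete_series 1 * elementary_series (- 1))"
    by (simp add: complete_series_mult_elementary_series)
  also have "\<dots> = (?M * elementary_series (- 1)) * complete_series 1"
    by (simp only: ac_simps)
  also have "\<dots> = (mmonom t {#} * eulerian_series t + mmonom (1 - t) {#}) * complete_series 1"
    by (simp only: diagonal_eulerian_form_mult_elementary_series)
  finally show ?thesis by (simp add: algebra_simps)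
qed

section \<open>Monotone rearrangements\<close>

lemma mono_on_eq_if_image_mset_eq:
  fixes f g :: "'i::linorder \<Rightarrow> 'k::linorder"
  assumes "finite A" "mono_on A f" "mono_on A g"
    and "image_mset f (mset_set A) = image_mset g (mset_set A)" and "x \<in> A"
  shows "f x = g x"
proof -
  let ?xs = "sorted_list_of_set A"
  have "sorted (map h ?xs)" if "mono_on A h" for h :: "'i \<Rightarrow> 'k"
    using assms(1) that
    by (auto simp: sorted_map dest: mono_onD
        intro!: sorted_wrt_mono_rel[OF _ sorted_sorted_list_of_set])
  moreover have "mset (map f ?xs) = mset (map g ?xs)"
    using assms(4) by (simp flip: sorted_list_of_mset_set)
  ultimately have "map f ?xs = map g ?xs"
    using assms(2,3) by (metis properties_for_sort)
  thus ?thesis using assms(1,5) by simp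
qed

lemma ex_sorting_permutation:
  fixes key :: "nat \<Rightarrow> 'k::linorder"
  assumes "inj_on key {1..n}"
  obtains \<sigma> where "\<sigma> permutes {1..n}" "strict_mono_on {1..n} (key \<circ> \<sigma>)"
proof -
  define xs where "xs = sort_key key [1..<Suc n]"
  define \<sigma> where "\<sigma> i = (if i \<in> {1..n} then xs ! (i - 1) else i)" for i
  have xs: "set xs = {1..n}" "length xs = n" "distinct xs"
    by (auto simp: xs_def simp del: upt_Suc)
  have "bij_betw (\<lambda>i. i - 1) {1..n} {..<length xs}"
    by (rule bij_betwI[of _ _ _ Suc]) (auto simp: xs)
  hence "bij_betw ((!) xs \<circ> (\<lambda>i. i - 1)) {1..n} {1..n}"
    using bij_betw_nth[OF \<open>distinct xs\<close> refl refl] unfolding xs(1) by (rule bij_betw_trans)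
  moreover have "bij_betw \<sigma> {1..n} {1..n} \<longleftrightarrow> bij_betw ((!) xs \<circ> (\<lambda>i. i - 1)) {1..n} {1..n}"
    by (rule bij_betw_cong) (simp add: \<sigma>_def)
  ultimately have "bij_betw \<sigma> {1..n} {1..n}" by simp
  hence perm: "\<sigma> permutes {1..n}" by (rule bij_imp_permutes) (auto simp: \<sigma>_def)
  moreover have "strict_mono_on {1..n} (key \<circ> \<sigma>)"
  proof (rule strict_mono_onI)
    fix i j assume ij: "i \<in> {1..n}" "j \<in> {1..n}" "i < j"
    have "sorted (map key xs)" by (simp add: xs_def)
    hence "key (\<sigma> i) \<le> key (\<sigma> j)"
      using ij sorted_nth_mono[of "map key xs" "i - 1" "j - 1"] by (simp add: \<sigma>_def xs)
    moreover have "key (\<sigma> i) \<noteq> key (\<sigma> j)"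
      using ij inj_onD[OF assms, of "\<sigma> i" "\<sigma> j"] injD[OF permutes_inj[OF perm], of i j]
        permutes_in_image[OF perm] by fastforce
    ultimately show "(key \<circ> \<sigma>) i < (key \<circ> \<sigma>) j" by simp
  qed
  ultimately show thesis by (rule that)
qed

lemma strict_mono_on_atLeastAtMost_iff:
  fixes f :: "nat \<Rightarrow> 'k::order"
  shows "strict_mono_on {a..b} f \<longleftrightarrow> (\<forall>i\<in>{a..<b}. f i < f (Suc i))"
proof
  assume step: "\<forall>i\<in>{a..<b}. f i < f (Suc i)"
  have "f i < f j" if "i < j" "a \<le> i" "j \<le> b" for i j
    using that by (induction rule: strict_inc_induct) (use step in \<open>auto intro: less_trans\<close>)
  thus "strict_mono_on {a..b} f" by (auto intro: strict_mono_onI)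
qed (auto intro: strict_mono_onD)

lemma prod_first_occurrences:
  fixes w :: "'i::linorder \<Rightarrow> 'v" and f g :: "'v \<Rightarrow> 'r::comm_monoid_mult"
  assumes "finite A"
  shows "(\<Prod>p\<in>A. if \<exists>q\<in>A. q < p \<and> w q = w p then g (w p) else f (w p)) =
    (\<Prod>v\<in>w ` A. f v * g v ^ (card {p\<in>A. w p = v} - 1))"
proof -
  let ?h = "\<lambda>p. if \<exists>q\<in>A. q < p \<and> w q = w p then g (w p) else f (w p)"
  have "prod ?h {p\<in>A. w p = v} = f v * g v ^ (card {p\<in>A. w p = v} - 1)" if "v \<in> w ` A" for v
  proof -
    let ?B = "{p\<in>A. w p = v}"
    have B: "finite ?B" "?B \<noteq> {}" using assms that by auto
    have "prod ?h ?B = ?h (Min ?B) * prod ?h (?B - {Min ?B})"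
      using B Min_in[OF B] by (intro prod.remove)
    also have "?h (Min ?B) = f v"
      using Min_in[OF B] Min_le[OF B(1)] by (auto dest: leD)
    also have "prod ?h (?B - {Min ?B}) = (\<Prod>p\<in>?B - {Min ?B}. g v)"
    proof (rule prod.cong[OF refl])
      fix p assume p: "p \<in> ?B - {Min ?B}"
      hence "Min ?B < p" using Min_le[OF B(1), of p] by auto
      thus "?h p = g v" using p Min_in[OF B] by auto
    qed
    finally show ?thesis using B Min_in[OF B] by simp
  qed
  thus ?thesis using assms by (simp add: prod.image_gen[of A ?h w])
qed

lemma image_mset_permutes:
  assumes "\<sigma> permutes A"
  shows "image_mset (f \<circ> \<sigma>) (mset_set A) = image_mset f (mset_set A)"
  using assms
  by (simp add: image_mset_mset_set permutes_inj_on permutes_image flip: multiset.map_comp)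

section \<open>Permutations compatible with a weakly decreasing word\<close>

lemma letter_less_bar_word_iff:
  "letter_less (bar_word \<sigma> i) (bar_word \<sigma> j) \<longleftrightarrow> (\<not> i < \<sigma> i, \<sigma> i) < (\<not> j < \<sigma> j, \<sigma> j)"
  by (auto simp: bar_word_def)

text \<open>
  Sorting the values by this key recovers a permutation from its code; the sign is there because
  words are weakly decreasing.
\<close>

definition code_key :: "(nat \<Rightarrow> nat \<times> bool) \<Rightarrow> nat \<Rightarrow> int \<times> bool \<times> nat" where
  "code_key g p = (- int (fst (g p)), \<not> snd (g p), p)"

lemma inj_on_code_key: "inj_on (code_key g) A"
  by (auto simp: code_key_def intro: inj_onI)

locale decreasing_word =
  fixes n :: nat and w :: "nat \<Rightarrow> nat"
  assumes antimono: "antimono_on {1..n} w"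
begin

lemma letter_antimono: "i \<le> j \<Longrightarrow> i \<in> {1..n} \<Longrightarrow> j \<in> {1..n} \<Longrightarrow> w j \<le> w i"
  using monotone_onD[OF antimono] by blast

lemma position_less_if_letter_greater: "i \<in> {1..n} \<Longrightarrow> j \<in> {1..n} \<Longrightarrow> w i < w j \<Longrightarrow> j < i"
  using letter_antimono by (meson leD leI)

definition compatible :: "(nat \<Rightarrow> nat) \<Rightarrow> bool" where
  "compatible \<sigma> \<longleftrightarrow> (\<forall>j\<in>EXD n \<sigma>. w (j + 1) < w j)"

definition content :: "nat multiset" where
  "content = image_mset w (mset_set {1..n})"

definition value_code :: "(nat \<Rightarrow> nat) \<Rightarrow> nat \<Rightarrow> nat \<times> bool" where
  "value_code \<sigma> = (\<lambda>p\<in>{1..n}. (w (inv \<sigma> p), inv \<sigma> p < p))"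

text \<open>
  A barred value \<open>p\<close> may be put into the block of \<open>k\<close> iff that block has a position before \<open>p\<close>, a
  plain one iff it has a position at or after \<open>p\<close>; since barred letters come first and each kind
  increases along a block, this already forces every barred letter to be an excedance and every
  plain one not to be.
\<close>

definition choices :: "nat \<Rightarrow> (nat \<times> bool) set" where
  "choices p = (\<lambda>i. (w i, i < p)) ` {1..n}"

definition codes :: "(nat \<Rightarrow> nat \<times> bool) set" where
  "codes = {g \<in> PiE {1..n} choices. image_mset (fst \<circ> g) (mset_set {1..n}) = content}"

lemma value_code_apply:
  assumes "\<sigma> permutes {1..n}" "i \<in> {1..n}"
  shows "value_code \<sigma> (\<sigma> i) = (w i, i < \<sigma> i)"
  using assms permutes_in_image[OF assms(1), of i]
  by (simp add: value_code_def permutes_inverses)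

lemma value_code_in_codes:
  assumes "\<sigma> permutes {1..n}"
  shows "value_code \<sigma> \<in> codes"
proof -
  have "value_code \<sigma> \<in> PiE {1..n} choices"
    using permutes_in_image[OF permutes_inv[OF assms]]
    by (auto simp: value_code_def choices_def)
  moreover have "image_mset (fst \<circ> value_code \<sigma>) (mset_set {1..n}) = content"
  proof -
    have "image_mset (fst \<circ> value_code \<sigma>) (mset_set {1..n}) =
        image_mset (fst \<circ> value_code \<sigma> \<circ> \<sigma>) (mset_set {1..n})"
      using assms by (rule image_mset_permutes[symmetric])
    also have "\<dots> = image_mset w (mset_set {1..n})"
      by (rule image_mset_cong) (simp add: value_code_apply[OF assms])
    finally show ?thesis by (simp add: content_def)
  qed
  ultimately show ?thesis by (simp add: codes_def)
qed

lemma compatible_iff_strict_mono_on: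
  assumes "\<sigma> permutes {1..n}"
  shows "compatible \<sigma> \<longleftrightarrow> strict_mono_on {1..n} (code_key (value_code \<sigma>) \<circ> \<sigma>)"
proof -
  let ?key = "code_key (value_code \<sigma>) \<circ> \<sigma>"
  have "?key i < ?key (Suc i) \<longleftrightarrow> (i \<in> EXD n \<sigma> \<longrightarrow> w (Suc i) < w i)" if i: "i \<in> {1..<n}" for i
  proof -
    have "?key j = (- int (w j), \<not> j < \<sigma> j, \<sigma> j)" if "j \<in> {1..n}" for j
      using assms that by (simp add: code_key_def value_code_apply)
    moreover have "\<sigma> i \<noteq> \<sigma> (Suc i)" using assms by (metis n_not_Suc_n permutes_def)
    ultimately show ?thesis
      using i letter_antimono[of i "Suc i"] by (auto simp: EXD_def letter_less_bar_word_iff)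
  qed
  thus ?thesis
    unfolding compatible_def strict_mono_on_atLeastAtMost_iff by (auto simp: EXD_def)
qed

lemma inj_on_value_code: "inj_on value_code {\<sigma>. \<sigma> permutes {1..n} \<and> compatible \<sigma>}"
proof (rule inj_onI, safe)
  fix \<sigma> \<tau>
  assume perm: "\<sigma> permutes {1..n}" "\<tau> permutes {1..n}" and "compatible \<sigma>" "compatible \<tau>"
    and code: "value_code \<sigma> = value_code \<tau>"
  let ?key = "code_key (value_code \<sigma>)"
  have "mono_on {1..n} (?key \<circ> \<sigma>)" "mono_on {1..n} (?key \<circ> \<tau>)"
    using \<open>compatible \<sigma>\<close> \<open>compatible \<tau>\<close> perm compatible_iff_strict_mono_on code
    by (auto intro: strict_mono_on_imp_mono_on)
  hence "(?key \<circ> \<sigma>) i = (?key \<circ> \<tau>) i" if "i \<in> {1..n}" for i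
    using perm that
    by (intro mono_on_eq_if_image_mset_eq[of "{1..n}"])
      (simp_all only: image_mset_permutes finite_atLeastAtMost)
  hence "\<sigma> i = \<tau> i" if "i \<in> {1..n}" for i
    using that by (auto simp: code_key_def)
  moreover have "\<sigma> i = \<tau> i" if "i \<notin> {1..n}" for i
    using that perm by (auto simp: permutes_def)
  ultimately show "\<sigma> = \<tau>" by blast
qed

end

locale sorted_code = decreasing_word +
  fixes g :: "nat \<Rightarrow> nat \<times> bool" and \<sigma> :: "nat \<Rightarrow> nat"
  assumes code: "g \<in> codes"
    and permutes: "\<sigma> permutes {1..n}"
    and sorted: "strict_mono_on {1..n} (code_key g \<circ> \<sigma>)"
begin

lemma fst_code_eq:
  assumes "i \<in> {1..n}"
  shows "fst (g (\<sigma> i)) = w i"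
proof -
  let ?f = "\<lambda>i. - int (fst (g (\<sigma> i)))" and ?h = "\<lambda>i. - int (w i)"
  have "mono_on {1..n} ?f"
  proof (rule mono_onI)
    fix i j assume "i \<in> {1..n}" "j \<in> {1..n}" "i \<le> j"
    hence "code_key g (\<sigma> i) \<le> code_key g (\<sigma> j)"
      using strict_mono_on_leD[OF sorted] by simp
    thus "?f i \<le> ?f j" by (auto simp: code_key_def)
  qed
  moreover have "mono_on {1..n} ?h" using letter_antimono by (auto intro: mono_onI)
  moreover have "image_mset ?f (mset_set {1..n}) = image_mset ?h (mset_set {1..n})"
  proof -
    have "image_mset (fst \<circ> g \<circ> \<sigma>) (mset_set {1..n}) = image_mset w (mset_set {1..n})"
      using image_mset_permutes[OF permutes, of "fst \<circ> g"] code
      by (simp only: codes_def content_def mem_Collect_eq)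
    from arg_cong[OF this, of "image_mset (\<lambda>k. - int k)"] show ?thesis
      by (simp add: multiset.map_comp comp_def)
  qed
  ultimately have "?f i = ?h i"
    using assms by (intro mono_on_eq_if_image_mset_eq[of "{1..n}" ?f ?h]) auto
  thus ?thesis by simp
qed

lemma ex_position_in_block:
  assumes "i \<in> {1..n}"
  shows "\<exists>j\<in>{1..n}. w j = w i \<and> (snd (g (\<sigma> i)) \<longleftrightarrow> j < \<sigma> i)"
proof -
  have "\<sigma> i \<in> {1..n}" using assms permutes_in_image[OF permutes] by simp
  hence "g (\<sigma> i) \<in> choices (\<sigma> i)" using code by (auto simp: codes_def)
  then obtain j where "j \<in> {1..n}" "g (\<sigma> i) = (w j, j < \<sigma> i)"
    unfolding choices_def by blast
  thus ?thesis using fst_code_eq[OF assms] by (intro bexI[of _ j]) simp_all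
qed

lemma increasing_along_block:
  assumes "i \<in> {1..n}" "Suc i \<in> {1..n}" "w i = w (Suc i)"
  shows "(\<not> snd (g (\<sigma> i)), \<sigma> i) < (\<not> snd (g (\<sigma> (Suc i))), \<sigma> (Suc i))"
  using strict_mono_onD[OF sorted assms(1,2)] fst_code_eq[OF assms(1)] fst_code_eq[OF assms(2)] assms
  by (auto simp: code_key_def)

lemma barred_imp_excedance: "i \<in> {1..n} \<Longrightarrow> snd (g (\<sigma> i)) \<Longrightarrow> i < \<sigma> i"
proof (induction i)
  case (Suc i)
  obtain j where j: "j \<in> {1..n}" "w j = w (Suc i)" "j < \<sigma> (Suc i)"
    using ex_position_in_block[OF Suc.prems(1)] Suc.prems(2) by blast
  show ?case
  proof (cases "i \<in> {1..n} \<and> w i = w (Suc i)")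
    case True
    thus ?thesis using increasing_along_block[of i] Suc by auto
  next
    case False
    hence "\<not> j \<le> i"
      using j Suc.prems letter_antimono[of j i] letter_antimono[of i "Suc i"] by auto
    thus ?thesis using j by simp
  qed
qed simp

lemma plain_imp_not_excedance: "i \<in> {1..n} \<Longrightarrow> \<not> snd (g (\<sigma> i)) \<Longrightarrow> \<sigma> i \<le> i"
proof (induction "n - i" arbitrary: i rule: less_induct)
  case less
  obtain j where j: "j \<in> {1..n}" "w j = w i" "\<sigma> i \<le> j"
    using ex_position_in_block[OF less.prems(1)] less.prems(2) by (auto simp: not_less)
  show ?case
  proof (cases "Suc i \<in> {1..n} \<and> w i = w (Suc i)")
    case True
    thus ?thesis
      using increasing_along_block[of i] less.hyps[of "Suc i"] less.prems by fastforce
  next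
    case False
    hence "\<not> Suc i \<le> j"
      using j less.prems letter_antimono[of i "Suc i"] letter_antimono[of "Suc i" j] by auto
    thus ?thesis using j by simp
  qed
qed

lemma value_code_eq: "value_code \<sigma> = g"
proof (rule PiE_ext)
  show "value_code \<sigma> \<in> PiE {1..n} choices" "g \<in> PiE {1..n} choices"
    using value_code_in_codes[OF permutes] code by (simp_all add: codes_def)
  fix p assume "p \<in> {1..n}"
  define i where "i = inv \<sigma> p"
  have p: "p = \<sigma> i" using permutes by (simp add: i_def permutes_inverses)
  have i: "i \<in> {1..n}" using \<open>p \<in> {1..n}\<close> permutes_in_image[OF permutes] unfolding p by blast
  hence "snd (g p) \<longleftrightarrow> i < p"
    using barred_imp_excedance plain_imp_not_excedance unfolding p by (meson not_less)
  thus "value_code \<sigma> p = g p"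
    using i fst_code_eq by (simp add: p value_code_apply[OF permutes] prod_eq_iff)
qed

end

context decreasing_word
begin

lemma value_code_surj:
  assumes "g \<in> codes"
  obtains \<sigma> where "\<sigma> permutes {1..n}" "compatible \<sigma>" "value_code \<sigma> = g"
proof -
  obtain \<sigma> where \<sigma>: "\<sigma> permutes {1..n}" "strict_mono_on {1..n} (code_key g \<circ> \<sigma>)"
    using ex_sorting_permutation[OF inj_on_code_key] .
  then interpret sorted_code n w g \<sigma>
    using assms by unfold_locales
  have "compatible \<sigma>"
    using \<sigma> by (simp add: compatible_iff_strict_mono_on value_code_eq)
  thus thesis using that \<sigma>(1) value_code_eq by blast
qed

lemma bij_betw_value_code:
  "bij_betw value_code {\<sigma>. \<sigma> permutes {1..n} \<and> compatible \<sigma>} codes"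
proof (rule bij_betw_imageI[OF inj_on_value_code])
  show "value_code ` {\<sigma>. \<sigma> permutes {1..n} \<and> compatible \<sigma>} = codes"
    using value_code_in_codes by (auto elim!: value_code_surj)
qed

lemma prod_value_code_weights:
  fixes t :: "'a::comm_ring_1"
  assumes "\<sigma> permutes {1..n}"
  shows "(\<Prod>p\<in>{1..n}. if snd (value_code \<sigma> p) then t else 1) = t ^ exc n \<sigma>"
proof -
  have "(\<Prod>p\<in>{1..n}. if snd (value_code \<sigma> p) then t else 1) =
      (\<Prod>i\<in>{1..n}. if snd (value_code \<sigma> (\<sigma> i)) then t else 1)"
    using prod.permute[OF assms] by (simp add: comp_def)
  also have "\<dots> = (\<Prod>i\<in>{1..n}. if i < \<sigma> i then t else 1)"
    by (rule prod.cong) (simp_all add: value_code_apply[OF assms])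
  also have "\<dots> = t ^ card {i\<in>{1..n}. i < \<sigma> i}"
    by (simp flip: prod.inter_filter)
  also have "{i\<in>{1..n}. i < \<sigma> i} = {i\<in>{1..<n}. i < \<sigma> i}"
  proof -
    have "\<sigma> n \<le> n" using permutes_in_image[OF assms, of n] permutes_not_in[OF assms, of n] by force
    thus ?thesis by (auto simp: le_less)
  qed
  finally show ?thesis by (simp add: exc_def)
qed

lemma sum_compatible_eq_mcoeff_prod_choices:
  fixes t :: "'a::comm_ring_1"
  shows "(\<Sum>\<sigma> | \<sigma> permutes {1..n} \<and> compatible \<sigma>. t ^ exc n \<sigma>) =
    mcoeff (\<Prod>p\<in>{1..n}. \<Sum>c\<in>choices p. mmonom (if snd c then t else 1) {#fst c#}) content"
proof -
  have "(\<Sum>\<sigma> | \<sigma> permutes {1..n} \<and> compatible \<sigma>. t ^ exc n \<sigma>) =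
      (\<Sum>\<sigma> | \<sigma> permutes {1..n} \<and> compatible \<sigma>.
        \<Prod>p\<in>{1..n}. if snd (value_code \<sigma> p) then t else 1)"
    by (rule sum.cong) (simp_all only: prod_value_code_weights mem_Collect_eq)
  also have "\<dots> = (\<Sum>g\<in>codes. \<Prod>p\<in>{1..n}. if snd (g p) then t else 1)"
    by (rule sum.reindex_bij_betw[OF bij_betw_value_code])
  also have "codes = {g \<in> PiE {1..n} choices. (\<Sum>p\<in>{1..n}. {#fst (g p)#}) = content}"
    by (simp add: codes_def comp_def sum_unfold_sum_mset)
  also have "(\<Sum>g\<in>\<dots>. \<Prod>p\<in>{1..n}. if snd (g p) then t else 1) =
      mcoeff (\<Prod>p\<in>{1..n}. \<Sum>c\<in>choices p. mmonom (if snd c then t else 1) {#fst c#}) content"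
    by (rule mcoeff_prod_sum_mmonom[symmetric]) (simp_all add: choices_def)
  finally show ?thesis .
qed

definition repeats_letter :: "nat \<Rightarrow> bool" where
  "repeats_letter p \<longleftrightarrow> (\<exists>i\<in>{1..n}. i < p \<and> w i = w p)"

lemma mem_choices_iff: "(k, b) \<in> choices p \<longleftrightarrow> (\<exists>i\<in>{1..n}. w i = k \<and> (i < p \<longleftrightarrow> b))"
  by (auto simp: choices_def)

lemma barred_mem_choices_iff:
  assumes "p \<in> {1..n}"
  shows "(k, True) \<in> choices p \<longleftrightarrow> k \<in> w ` {1..n} \<and> (w p < k \<or> k = w p \<and> repeats_letter p)"
proof
  assume "(k, True) \<in> choices p"
  then obtain i where "i \<in> {1..n}" "w i = k" "i < p" unfolding mem_choices_iff by blast
  thus "k \<in> w ` {1..n} \<and> (w p < k \<or> k = w p \<and> repeats_letter p)"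
    using letter_antimono[of i p] assms by (auto simp: repeats_letter_def le_less)
next
  assume "k \<in> w ` {1..n} \<and> (w p < k \<or> k = w p \<and> repeats_letter p)"
  then consider i where "i \<in> {1..n}" "w i = k" "w p < w i" | "k = w p" "repeats_letter p" by auto
  thus "(k, True) \<in> choices p"
  proof cases
    case 1
    thus ?thesis using position_less_if_letter_greater[OF assms] unfolding mem_choices_iff by blast
  next
    case 2
    thus ?thesis unfolding repeats_letter_def mem_choices_iff by auto
  qed
qed

lemma plain_mem_choices_iff:
  assumes "p \<in> {1..n}"
  shows "(k, False) \<in> choices p \<longleftrightarrow> k \<in> w ` {1..n} \<and> k \<le> w p"
proof
  assume "(k, False) \<in> choices p"
  then obtain i where "i \<in> {1..n}" "w i = k" "p \<le> i" unfolding mem_choices_iff by force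
  thus "k \<in> w ` {1..n} \<and> k \<le> w p" using letter_antimono[of p i] assms by auto
next
  assume "k \<in> w ` {1..n} \<and> k \<le> w p"
  then consider i where "i \<in> {1..n}" "w i = k" "w i < w p" | "k = w p" by fastforce
  thus "(k, False) \<in> choices p"
  proof cases
    case (1 i)
    hence "p < i" using position_less_if_letter_greater assms by blast
    thus ?thesis using 1 unfolding mem_choices_iff by (intro bexI[of _ i]) auto
  next
    case 2
    thus ?thesis using assms unfolding mem_choices_iff by (intro bexI[of _ p]) auto
  qed
qed

definition value_form :: "'a::comm_ring_1 \<Rightarrow> nat \<Rightarrow> (nat, 'a) mvps" where
  "value_form t p = (if repeats_letter p then eulerian_form t (w p)
     else eulerian_form t (w p) + mmonom (- t) {#w p#})"

lemma sum_choices_eq_value_form: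
  fixes t :: "'a::comm_ring_1"
  assumes "p \<in> {1..n}"
  shows "(\<Sum>c\<in>choices p. mmonom (if snd c then t else 1) {#fst c#}) =
    restrict_vars (w ` {1..n}) (value_form t p)"
proof -
  let ?A = "{k \<in> w ` {1..n}. w p < k \<or> k = w p \<and> repeats_letter p}"
  let ?B = "{k \<in> w ` {1..n}. k \<le> w p}"
  let ?m = "\<lambda>c. mmonom (if snd c then t else 1) {#fst c#}"
  have "(k, b) \<in> choices p \<longleftrightarrow> (k, b) \<in> ?A \<times> {True} \<union> ?B \<times> {False}" for k b
    by (cases b) (simp_all add: barred_mem_choices_iff[OF assms] plain_mem_choices_iff[OF assms])
  hence "choices p = ?A \<times> {True} \<union> ?B \<times> {False}" by (intro equalityI subrelI) simp_all
  hence "sum ?m (choices p) = sum ?m (?A \<times> {True}) + sum ?m (?B \<times> {False})"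
    by (simp only:) (rule sum.union_disjoint, auto)
  also have "\<dots> = (\<Sum>k\<in>?A. mmonom t {#k#}) + (\<Sum>k\<in>?B. mmonom 1 {#k#})"
    by (simp add: sum.cartesian_product')
  also have "\<dots> = linear_form (\<lambda>k. (if k \<in> ?A then t else 0) + (if k \<in> ?B then 1 else 0))"
    by (simp add: sum_mmonom_single linear_form_add)
  also have "\<dots> = restrict_vars (w ` {1..n}) (value_form t p)"
    unfolding value_form_def eulerian_form_add_mmonom unfolding eulerian_form_def
    by (auto simp: restrict_vars_linear_form intro!: linear_form_cong)
  finally show ?thesis .
qed

lemma sum_compatible_eq_mcoeff_eulerian_series:
  fixes t :: "'a::comm_ring_1"
  shows "(\<Sum>\<sigma> | \<sigma> permutes {1..n} \<and> compatible \<sigma>. t ^ exc n \<sigma>) =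
    mcoeff (eulerian_series t) content"
proof -
  have "(\<Sum>\<sigma> | \<sigma> permutes {1..n} \<and> compatible \<sigma>. t ^ exc n \<sigma>) =
      mcoeff (\<Prod>p\<in>{1..n}. restrict_vars (w ` {1..n}) (value_form t p)) content"
    unfolding sum_compatible_eq_mcoeff_prod_choices
    by (intro arg_cong2[of _ _ _ _ mcoeff] prod.cong sum_choices_eq_value_form refl)
  also have "\<dots> = mcoeff (\<Prod>p\<in>{1..n}. value_form t p) content"
    by (simp add: mcoeff_restrict_vars content_def flip: restrict_vars_prod)
  also have "(\<Prod>p\<in>{1..n}. value_form t p) = (\<Prod>k\<in>w ` {1..n}.
      (eulerian_form t k + mmonom (- t) {#k#}) *
      eulerian_form t k ^ (card {p\<in>{1..n}. w p = k} - 1))"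
    unfolding value_form_def repeats_letter_def by (rule prod_first_occurrences) simp
  also have "mcoeff \<dots> content = mcoeff (eulerian_series t) content"
    by (simp add: mcoeff_eulerian_series content_def count_image_mset_eq_card_vimage)
  finally show ?thesis .
qed

end

section \<open>Words with a given content\<close>

lemma mcoeff_word_series_unique:
  assumes "mset w0 = m" "\<And>w. w \<in> A \<Longrightarrow> mset w = m \<Longrightarrow> w = w0"
  shows "mcoeff (word_series A) m = of_bool (w0 \<in> A)"
proof -
  have "w \<in> A \<and> mset w = m \<longleftrightarrow> w = w0 \<and> w0 \<in> A" for w using assms by blast
  hence "{w \<in> A. mset w = m} = (if w0 \<in> A then {w0} else {})" by auto
  thus ?thesis by (simp add: word_series_def)
qed

lemma mcoeff_hsym: "mcoeff (hsym n) m = of_bool (size m = n \<and> set_mset m \<subseteq> {1..})"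
proof -
  let ?w = "sorted_list_of_multiset m"
  have "mcoeff (hsym n) m =
      of_bool (?w \<in> {w. length w = n \<and> (\<forall>i\<in>set w. 1 \<le> i) \<and> sorted w})"
    unfolding hsym_def
    by (rule mcoeff_word_series_unique) (auto simp: sorted_sort_id)
  thus ?thesis by (auto simp flip: size_mset)
qed

definition decreasing_list :: "'v::linorder multiset \<Rightarrow> 'v list" where
  "decreasing_list m = rev (sorted_list_of_multiset m)"

lemma mset_decreasing_list [simp]: "mset (decreasing_list m) = m"
  and set_decreasing_list [simp]: "set (decreasing_list m) = set_mset m"
  by (simp_all add: decreasing_list_def)

lemma length_decreasing_list [simp]: "length (decreasing_list m) = size m"
  by (simp flip: size_mset)

lemma decreasing_list_antimono:
  "i \<le> j \<Longrightarrow> j < size m \<Longrightarrow> decreasing_list m ! j \<le> decreasing_list m ! i"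
  using sorted_rev_nth_mono[of "decreasing_list m" i j] length_decreasing_list[of m]
  by (simp add: decreasing_list_def)

lemma image_mset_nth_pred: "image_mset (\<lambda>i. xs ! (i - 1)) (mset_set {1..length xs}) = mset xs"
proof -
  have "bij_betw (\<lambda>i. i - 1) {1..length xs} {0..<length xs}"
    by (rule bij_betwI[of _ _ _ Suc]) auto
  hence "image_mset (\<lambda>i. i - 1) (mset_set {1..length xs}) = mset_set {0..<length xs}"
    by (simp add: bij_betw_def image_mset_mset_set)
  from arg_cong[OF this, of "image_mset ((!) xs)"]
  have "image_mset (\<lambda>i. xs ! (i - 1)) (mset_set {1..length xs}) =
      mset (map ((!) xs) [0..<length xs])"
    by (simp add: multiset.map_comp comp_def)
  thus ?thesis by (simp only: map_nth)
qed

lemma eq_decreasing_list: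
  assumes "\<forall>j\<in>{1..<length w}. w ! (j - 1) \<ge> w ! j"
  shows "w = decreasing_list (mset w)"
proof -
  have "sorted (rev w)"
    unfolding sorted_rev_iff_nth_Suc using assms
    by (metis One_nat_def Suc_leI atLeastLessThan_iff diff_Suc_1 zero_less_Suc)
  thus ?thesis
    by (simp add: decreasing_list_def properties_for_sort[of "rev w" w])
qed

lemma mcoeff_Fquasi:
  "mcoeff (Fquasi S n) m = of_bool (size m = n \<and> set_mset m \<subseteq> {1..} \<and>
     (\<forall>j\<in>S. decreasing_list m ! j < decreasing_list m ! (j - 1)))"
proof -
  let ?A = "{w. length w = n \<and> (\<forall>i\<in>set w. 1 \<le> i) \<and> (\<forall>j\<in>{1..<n}. w ! (j - 1) \<ge> w ! j) \<and>
    (\<forall>j\<in>S. w ! (j - 1) > w ! j)}"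
  have "mcoeff (Fquasi S n) m = of_bool (decreasing_list m \<in> ?A)"
    unfolding Fquasi_def
    by (rule mcoeff_word_series_unique) (use eq_decreasing_list in auto)
  thus ?thesis by (auto intro: decreasing_list_antimono)
qed

section \<open>Transfer to series in t and z\<close>

definition graded_series :: "('v, 'a::comm_ring_1 fps) mvps \<Rightarrow> ('v, 'a) mvps fps fps" where
  "graded_series f = Abs_fps (\<lambda>n. Abs_fps (\<lambda>j. Abs_mvps (\<lambda>m.
     if size m = n then fps_nth (mcoeff f m) j else 0)))"

lemma mcoeff_graded_series:
  "mcoeff (fps_nth (fps_nth (graded_series f) n) j) m =
     (if size m = n then fps_nth (mcoeff f m) j else 0)"
  by (simp add: graded_series_def)

lemma mvps_fps_fps_eqI:
  assumes "\<And>n j m. mcoeff (fps_nth (fps_nth f n) j) m = mcoeff (fps_nth (fps_nth g n) j) m"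
  shows "f = (g :: ('v, 'a::comm_ring_1) mvps fps fps)"
  by (intro fps_ext mvps_eqI assms)

lemma graded_series_diff: "graded_series (f - g) = graded_series f - graded_series g"
  by (rule mvps_fps_fps_eqI) (simp add: mcoeff_graded_series)

lemma graded_series_one: "graded_series 1 = 1"
  by (rule mvps_fps_fps_eqI) (auto simp: mcoeff_graded_series mcoeff_one)

lemma sum_if_sizes_eq:
  assumes "(a, b) \<in> msplits m"
  shows "(\<Sum>k=0..n. if size a = k \<and> size b = n - k then x else 0) = (if size m = n then x else 0)"
proof -
  have m: "size m = size a + size b" using assms by (auto simp: msplits_def)
  hence "(\<Sum>k=0..n. if size a = k \<and> size b = n - k then x else 0) =
      (\<Sum>k=0..n. if k = size a then if size m = n then x else 0 else 0)"
    by (intro sum.cong) auto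
  thus ?thesis using m by auto
qed

lemma graded_series_mult: "graded_series (f * g) = graded_series f * graded_series g"
proof (rule mvps_fps_fps_eqI)
  fix n j m
  let ?c = "\<lambda>i p. fps_nth (mcoeff f (fst p)) i * fps_nth (mcoeff g (snd p)) (j - i)"
  have "mcoeff (fps_nth (fps_nth (graded_series f * graded_series g) n) j) m =
      (\<Sum>k=0..n. \<Sum>i=0..j. \<Sum>p\<in>msplits m.
        if size (fst p) = k \<and> size (snd p) = n - k then ?c i p else 0)"
    by (auto simp: fps_mult_nth fps_sum_nth mcoeff_mult mcoeff_graded_series case_prod_unfold
        intro!: sum.cong)
  also have "\<dots> = (\<Sum>k=0..n. \<Sum>p\<in>msplits m. \<Sum>i=0..j.
        if size (fst p) = k \<and> size (snd p) = n - k then ?c i p else 0)"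
    by (rule sum.cong[OF refl sum.swap])
  also have "\<dots> = (\<Sum>p\<in>msplits m. \<Sum>k=0..n.
        if size (fst p) = k \<and> size (snd p) = n - k then \<Sum>i=0..j. ?c i p else 0)"
    by (subst sum.swap) (auto intro!: sum.cong)
  also have "\<dots> = (\<Sum>p\<in>msplits m. if size m = n then \<Sum>i=0..j. ?c i p else 0)"
    by (rule sum.cong[OF refl sum_if_sizes_eq]) simp
  also have "\<dots> = mcoeff (fps_nth (fps_nth (graded_series (f * g)) n) j) m"
    by (simp add: mcoeff_graded_series mcoeff_mult case_prod_unfold fps_sum_nth fps_mult_nth)
  finally show "mcoeff (fps_nth (fps_nth (graded_series (f * g)) n) j) m =
    mcoeff (fps_nth (fps_nth (graded_series f * graded_series g) n) j) m" ..
qed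

definition positive_graded_series :: "(nat, int fps) mvps \<Rightarrow> xps fps fps" where
  "positive_graded_series f = graded_series (restrict_vars {1..} f)"

lemma mcoeff_positive_graded_series:
  "mcoeff (fps_nth (fps_nth (positive_graded_series f) n) j) m =
     (if size m = n \<and> set_mset m \<subseteq> {1..} then fps_nth (mcoeff f m) j else 0)"
  by (simp add: positive_graded_series_def mcoeff_graded_series mcoeff_restrict_vars)

lemma positive_graded_series_one: "positive_graded_series 1 = 1"
  and positive_graded_series_diff:
    "positive_graded_series (f - g) = positive_graded_series f - positive_graded_series g"
  and positive_graded_series_mult:
    "positive_graded_series (f * g) = positive_graded_series f * positive_graded_series g"
  by (simp_all add: positive_graded_series_def restrict_vars_one restrict_vars_diff
      restrict_vars_mult graded_series_one graded_series_diff graded_series_mult)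

lemma tvar_eq: "tvar = positive_graded_series (mmonom fps_X {#})"
  by (rule mvps_fps_fps_eqI)
    (auto simp: tvar_def mcoeff_positive_graded_series mcoeff_mmonom mcoeff_one fps_X_def)

lemma Hgen_eq: "Hgen = positive_graded_series (complete_series 1)"
  by (rule mvps_fps_fps_eqI)
    (simp add: Hgen_def mcoeff_positive_graded_series mcoeff_hsym complete_series_def)

lemma Hgen_compose_eq:
  "fps_compose Hgen (zvar * tvar) = positive_graded_series (complete_series fps_X)"
proof -
  have "fps_compose Hgen (zvar * tvar) = Abs_fps (\<lambda>n. fps_X ^ n * fps_nth Hgen n)"
    unfolding zvar_def tvar_def mult.commute[of fps_X] by (rule fps_compose_linear)
  thus ?thesis
    by (intro mvps_fps_fps_eqI)
      (simp add: Hgen_def mcoeff_positive_graded_series mcoeff_hsym complete_series_def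
        fps_X_power_mult_nth)
qed

lemma decreasing_word_decreasing_list: "decreasing_word (size m) (\<lambda>i. decreasing_list m ! (i - 1))"
  by (unfold_locales, rule monotone_onI, rule decreasing_list_antimono) auto

lemma mcoeff_Qeuler:
  "mcoeff (Qeuler n j) m =
    (if size m = n \<and> set_mset m \<subseteq> {1..} then fps_nth (mcoeff (eulerian_series fps_X) m) j else 0)"
proof (cases "size m = n \<and> set_mset m \<subseteq> {1..}")
  case True
  let ?w = "\<lambda>i. decreasing_list m ! (i - 1)"
  interpret decreasing_word n ?w
    using True decreasing_word_decreasing_list[of m] by simp
  have content: "content = m"
    unfolding content_def using True image_mset_nth_pred[of "decreasing_list m"] by simp
  have sum_filter: "(\<Sum>\<sigma> | \<sigma> permutes {1..n} \<and> P \<sigma>. f \<sigma>) =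
      (\<Sum>\<sigma> | \<sigma> permutes {1..n}. if P \<sigma> then f \<sigma> else 0)" for P and f :: "(nat \<Rightarrow> nat) \<Rightarrow> int"
    using sum.inter_filter[of "{\<sigma>. \<sigma> permutes {1..n}}" f P] by (simp add: finite_permutations)
  have "mcoeff (Qeuler n j) m =
      (\<Sum>\<sigma> | \<sigma> permutes {1..n} \<and> exc n \<sigma> = j. of_bool (compatible \<sigma>))"
    using True by (simp add: Qeuler_def mcoeff_Fquasi compatible_def del: One_nat_def)
  also have "\<dots> = (\<Sum>\<sigma> | \<sigma> permutes {1..n} \<and> compatible \<sigma>. of_bool (exc n \<sigma> = j))"
    unfolding sum_filter by (rule sum.cong) auto
  also have "\<dots> = fps_nth (\<Sum>\<sigma> | \<sigma> permutes {1..n} \<and> compatible \<sigma>. fps_X ^ exc n \<sigma>) j"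
    by (simp add: fps_sum_nth of_bool_def eq_commute[of j])
  finally show ?thesis
    unfolding sum_compatible_eq_mcoeff_eulerian_series content using True by simp
next
  case False
  hence "mcoeff (Fquasi S n) m = 0" for S unfolding mcoeff_Fquasi by auto
  thus ?thesis unfolding if_not_P[OF False] by (simp add: Qeuler_def)
qed

lemma Qgen_eq: "Qgen = positive_graded_series (eulerian_series fps_X)"
  by (rule mvps_fps_fps_eqI) (simp add: Qgen_def mcoeff_positive_graded_series mcoeff_Qeuler)

lemma one_minus_tvar_eq: "1 - tvar = positive_graded_series (mmonom (1 - fps_X) {#})"
proof -
  have "mmonom (1 - fps_X) {#} = (1 - mmonom fps_X {#} :: (nat, int fps) mvps)"
    by (rule mvps_eqI) (simp add: mcoeff_one mcoeff_mmonom)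
  thus ?thesis by (simp add: tvar_eq positive_graded_series_diff positive_graded_series_one)
qed

lemma fps_dvd_oneI:
  fixes f :: "'a::comm_ring_1 fps"
  assumes "fps_nth f 0 dvd 1"
  shows "f dvd 1"
proof -
  obtain c where "1 = fps_nth f 0 * c" using assms by (rule dvdE)
  hence "1 = f * fps_right_inverse f c" by (simp add: fps_right_inverse)
  thus ?thesis by (rule dvdI)
qed

lemma hsym_0: "hsym 0 = 1"
  by (rule mvps_eqI) (auto simp: mcoeff_hsym mcoeff_one)

lemma denominator_dvd_one: "fps_compose Hgen (zvar * tvar) - tvar * Hgen dvd 1"
  by (intro fps_dvd_oneI) (simp add: Hgen_def tvar_def zvar_def hsym_0)

theorem theorem2p1:
  shows "(fps_compose Hgen (zvar * tvar) - tvar * Hgen) dvd 1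
    \<and> Qgen = unit_quot ((1 - tvar) * Hgen) (fps_compose Hgen (zvar * tvar) - tvar * Hgen)"
proof
  show unit: "fps_compose Hgen (zvar * tvar) - tvar * Hgen dvd 1"
    by (rule denominator_dvd_one)
  have "Qgen * (fps_compose Hgen (zvar * tvar) - tvar * Hgen) = positive_graded_series
      (eulerian_series fps_X * (complete_series fps_X - mmonom fps_X {#} * complete_series 1))"
    unfolding Hgen_compose_eq
    by (simp only: Qgen_eq Hgen_eq tvar_eq positive_graded_series_diff positive_graded_series_mult)
  also have "\<dots> = (1 - tvar) * Hgen"
    by (simp only: eulerian_series_mult_complete_series_diff positive_graded_series_mult
        one_minus_tvar_eq Hgen_eq)
  finally show "Qgen = unit_quot ((1 - tvar) * Hgen) (fps_compose Hgen (zvar * tvar) - tvar * Hgen)"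
    by (simp only: unit_quot_eq_iff[OF unit])
qed

end
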